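(* Let $(\Omega, \mathcal{F}, \mu)$ be a probability space and fix $1 \leq p \leq \infty$. For any monotone Lipschitz function $\varphi \colon \mathbb{R} \rightarrow \mathbb{R}$ and any real-valued $f \in L^\infty(\Omega, \mu)$, we have $$\|\varphi(f) - \mathbb{E}\varphi(f)\|_p \leq \mathrm{Lip}(\varphi)\, \|f - \mathbb{E}f\|_p.$$
   Context: $\mathrm{Lip}(\varphi)$ denotes the Lipschitz constant of $\varphi$, i.e. the smallest $C \ge 0$ with $|\varphi(s)-\varphi(t)| \le C|s-t|$ for all $s,t$. $\varphi(f) = \varphi\circ f$. $\|\cdot\|_p$ denotes the usual norm of $L^p(\Omega,\mu)$ (the essential supremum norm if $p=\infty$) and $\mathbb{E}f = \int_\Omega f\, d\mu$. *)

theory Defs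
  imports "HOL-Probability.Probability"
begin

text \<open>The least constant exists (the admissible constants form a closed set bounded below by 0)
  exactly when \<open>\<phi>\<close> is Lipschitz; otherwise the value is unspecified.
  Non-negativity of \<open>C\<close> is part of \<^const>\<open>lipschitz_on\<close>.\<close>

definition Lip :: "(real \<Rightarrow> real) \<Rightarrow> real" where
  "Lip \<phi> = (LEAST C. C-lipschitz_on UNIV \<phi>)"

text \<open>The value is \<open>\<infinity>\<close> when the integral of \<open>\<bar>f\<bar>\<close> to the power \<open>p\<close> diverges; the case distinction is there
  because \<^const>\<open>powr\<close> is not available on \<^typ>\<open>ennreal\<close>. Meaningful for \<open>p \<ge> 1\<close> and measurable \<open>f\<close>.\<close>

definition Lp_norm :: "'a measure \<Rightarrow> ennreal \<Rightarrow> ('a \<Rightarrow> real) \<Rightarrow> ennreal" where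
  "Lp_norm M p f =
    (if p = \<infinity> then esssup M (\<lambda>x. ennreal \<bar>f x\<bar>)
     else let q = enn2real p; I = (\<integral>\<^sup>+x. ennreal (\<bar>f x\<bar> powr q) \<partial>M)
          in if I = \<infinity> then \<infinity> else ennreal (enn2real I powr (1 / q)))"

text \<open>Elements are functions, not classes modulo null sets.\<close>

definition Lp_space :: "'a measure \<Rightarrow> ennreal \<Rightarrow> ('a \<Rightarrow> real) set" where
  "Lp_space M p = {f \<in> borel_measurable M. Lp_norm M p f < \<infinity>}"

end

theory Submission
  imports Defs
begin

text \<open>
  Replacing \<open>\<phi>\<close> by \<open>-\<phi>\<close> if necessary, assume that \<open>\<phi>\<close> is increasing, and let \<open>L\<close> be its Lipschitz
  constant. Then \<open>L (f - E f) = G + H\<close> with \<open>G = \<phi>(f) - E \<phi>(f)\<close>, where the remainder \<open>H\<close> is an increasing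
  function of \<open>f\<close> as well, and has mean zero. For \<open>p < \<infinity>\<close>, let \<open>t\<close> be a level at which \<open>H\<close> vanishes
  and let \<open>k\<close> be a slope of the convex function \<open>\<psi> = \<bar>\<cdot>\<bar>\<^sup>p\<close> at the value of \<open>G\<close> there. As \<open>G\<close> and \<open>H\<close> increase
  together, \<open>\<psi>(G + H) \<ge> \<psi>(G) + k H\<close> pointwise, and it remains to integrate. For \<open>p = \<infinity>\<close>, put
  \<open>c = \<parallel>f - E f\<parallel>\<^sub>\<infinity>\<close>; then \<open>\<phi>(f) - E \<phi>(f) \<le> E (\<phi>(E f + c) - \<phi>(f)) \<le> L E (E f + c - f) = L c\<close>, and likewise
  from below.
\<close>

section \<open>Convexity on the line: powers of the absolute value, and subgradients\<close>

lemma convex_on_abs_powr: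
  fixes q :: real
  assumes q: "1 \<le> q"
  shows "convex_on UNIV (\<lambda>x::real. \<bar>x\<bar> powr q)"
proof (rule convex_onI)
  fix t x y :: real
  assume t: "0 < t" "t < 1"
  have "\<bar>(1 - t) *\<^sub>R x + t *\<^sub>R y\<bar> \<le> (1 - t) * \<bar>x\<bar> + t * \<bar>y\<bar>"
    using t abs_triangle_ineq[of "(1 - t) * x" "t * y"] by (simp add: abs_mult)
  then have "\<bar>(1 - t) *\<^sub>R x + t *\<^sub>R y\<bar> powr q \<le> ((1 - t) * \<bar>x\<bar> + t * \<bar>y\<bar>) powr q"
    using q by (intro powr_mono2) auto
  also have "\<dots> \<le> (1 - t) * \<bar>x\<bar> powr q + t * \<bar>y\<bar> powr q"
  proof -
    \<comment> \<open>If \<open>x\<close> or \<open>y\<close> is 0, the claim reduces to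
      \<open>s powr q \<le> s\<close> for \<open>0 < s < 1\<close>; otherwise it is convexity of the
      power on positive reals.\<close>
    have shrink: "(s * z) powr q \<le> s * z powr q" if "0 < s" "s < 1" "0 \<le> z" for s z :: real
    proof -
      have "s powr q \<le> s powr 1"
        using that q by (intro powr_mono') auto
      then show ?thesis
        using that by (simp add: powr_mult mult_right_mono)
    qed
    consider "x = 0" | "y = 0" | "0 < \<bar>x\<bar>" "0 < \<bar>y\<bar>"
      by fastforce
    then show ?thesis
    proof cases
      case 3
      then show ?thesis
        using convex_onD[OF powr_convex[OF q], of t "\<bar>x\<bar>" "\<bar>y\<bar>"] t by simp
    qed (use shrink[of t "\<bar>y\<bar>"] shrink[of "1 - t" "\<bar>x\<bar>"] t in simp_all)
  qed
  finally show "\<bar>(1 - t) *\<^sub>R x + t *\<^sub>R y\<bar> powr q \<le> (1 - t) * \<bar>x\<bar> powr q + t * \<bar>y\<bar> powr q" .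
qed simp

lemma convex_on_UNIV_subgradient:
  fixes \<psi> :: "real \<Rightarrow> real"
  assumes "convex_on UNIV \<psi>"
  obtains K where "mono K" "\<And>x y. \<psi> x + K x * (y - x) \<le> \<psi> y"
proof -
  \<comment> \<open>The infimum of the difference quotients to the right of \<open>x\<close>, that
    is, the right derivative of \<open>\<psi>\<close>.\<close>
  define K where "K x = Inf ((\<lambda>t. (\<psi> x - \<psi> t) / (x - t)) ` ({x<..} \<inter> UNIV))" for x
  have K: "\<psi> x + K x * (y - x) \<le> \<psi> y" for x y
    unfolding K_def using assms by (intro convex_le_Inf_differential) auto
  have "mono K"
  proof (rule monoI)
    fix x y :: real
    assume "x \<le> y"
    \<comment> \<open>Adding the subgradient inequalities from \<open>x\<close> to \<open>y\<close>
      and from \<open>y\<close> to \<open>x\<close> cancels the values of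
      \<open>\<psi>\<close>.\<close>
    have "0 \<le> (K y - K x) * (y - x)"
      using K[of x y] K[of y x] by (simp add: algebra_simps)
    with \<open>x \<le> y\<close> show "K x \<le> K y"
      by (cases "x = y") (auto simp: zero_le_mult_iff)
  qed
  with K that show ?thesis
    by blast
qed

section \<open>Expectations of functions of a random variable\<close>

context prob_space
begin

text \<open>A variable of mean zero is neither positive everywhere nor negative everywhere, so the
  intermediate value theorem applies to \<open>h\<close>. The zero \<open>t\<close> may lie outside
  the range of \<open>f\<close>.\<close>

lemma exists_zero_of_expectation_zero:
  fixes h :: "real \<Rightarrow> real"
  assumes "integrable M (\<lambda>x. h (f x))" "(\<integral>x. h (f x) \<partial>M) = 0" "continuous_on UNIV h"
  obtains t where "h t = 0"
proof -
  have "\<exists>x. h (f x) \<le> 0"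
    using expectation_greater[OF assms(1), of 0] assms(2) by (metis AE_I2 less_irrefl not_le)
  moreover have "\<exists>x. 0 \<le> h (f x)"
    using expectation_less[OF assms(1), of 0] assms(2) by (metis AE_I2 less_irrefl not_le)
  ultimately obtain a b where "h a \<le> 0" "0 \<le> h b"
    by blast
  moreover have "connected (range h)"
    using assms(3) by (intro connected_continuous_image) auto
  ultimately have "0 \<in> range h"
    by (meson connectedD_interval rangeI)
  with that show ?thesis
    by auto
qed

lemma expectation_convex_add_mono_ge:
  fixes f :: "'a \<Rightarrow> real" and g h \<psi> :: "real \<Rightarrow> real"
  assumes "mono g" "mono h" "continuous_on UNIV h" "convex_on UNIV \<psi>"
    and h: "integrable M (\<lambda>x. h (f x))" "(\<integral>x. h (f x) \<partial>M) = 0"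
    and \<psi>: "integrable M (\<lambda>x. \<psi> (g (f x)))" "integrable M (\<lambda>x. \<psi> (g (f x) + h (f x)))"
  shows "(\<integral>x. \<psi> (g (f x)) \<partial>M) \<le> (\<integral>x. \<psi> (g (f x) + h (f x)) \<partial>M)"
proof -
  obtain K where K: "mono K" "\<And>x y. \<psi> x + K x * (y - x) \<le> \<psi> y"
    using convex_on_UNIV_subgradient[OF assms(4)] by blast
  obtain t where t: "h t = 0"
    using exists_zero_of_expectation_zero[OF h assms(3)] by blast
  have *: "\<psi> (g s) + K (g t) * h s \<le> \<psi> (g s + h s)" for s
  proof -
    \<comment> \<open>The differences \<open>K (g s) - K (g t)\<close> and
      \<open>h s - h t = h s\<close> have the same sign. The slope thus becomes independent of
      \<open>s\<close>, and the linear term integrates to 0.\<close>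
    have "K (g t) * h s \<le> K (g s) * h s"
    proof (cases "s \<le> t")
      case True
      then show ?thesis
        using monoD[OF \<open>mono h\<close> True] monoD[OF K(1) monoD[OF \<open>mono g\<close> True]] t
        by (simp add: mult_right_mono_neg)
    next
      case False
      then have "t \<le> s" by simp
      then show ?thesis
        using monoD[OF \<open>mono h\<close> \<open>t \<le> s\<close>] monoD[OF K(1) monoD[OF \<open>mono g\<close> \<open>t \<le> s\<close>]] t
        by (simp add: mult_right_mono)
    qed
    then show ?thesis
      using K(2)[of "g s" "g s + h s"] by simp
  qed
  have "(\<integral>x. \<psi> (g (f x)) \<partial>M) = (\<integral>x. \<psi> (g (f x)) + K (g t) * h (f x) \<partial>M)"
    using h \<psi> by simp
  also have "\<dots> \<le> (\<integral>x. \<psi> (g (f x) + h (f x)) \<partial>M)"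
    using h \<psi> * by (intro integral_mono) auto
  finally show ?thesis .
qed

text \<open>Almost surely \<open>f\<close> stays in the compact interval \<open>{-B..B}\<close>,
  where \<open>u\<close> is bounded, and the measure is finite.\<close>

lemma integrable_continuous_bounded:
  fixes f :: "'a \<Rightarrow> real" and u :: "real \<Rightarrow> real"
  assumes [measurable]: "f \<in> borel_measurable M"
    and B: "AE x in M. \<bar>f x\<bar> \<le> B" and u: "continuous_on UNIV u"
  shows "integrable M (\<lambda>x. u (f x))"
proof -
  have "compact (u ` {-B..B})"
    by (intro compact_continuous_image continuous_on_subset[OF u]) auto
  then obtain C where C: "\<And>y. y \<in> {-B..B} \<Longrightarrow> norm (u y) \<le> C"
    by (meson bounded_iff compact_imp_bounded imageI)
  have [measurable]: "u \<in> borel_measurable borel"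
    using u by (rule borel_measurable_continuous_onI)
  show ?thesis
    using B by (intro integrable_const_bound[where B = C]) (auto elim!: eventually_mono intro!: C[unfolded real_norm_def])
qed

end

section \<open>Finite norms and the least Lipschitz constant\<close>

lemma Lp_norm_integrable:
  fixes u :: "'a \<Rightarrow> real"
  assumes "0 \<le> q" "integrable M (\<lambda>x. \<bar>u x\<bar> powr q)"
  shows "Lp_norm M (ennreal q) u = ennreal ((\<integral>x. \<bar>u x\<bar> powr q \<partial>M) powr (1 / q))"
  using assms by (simp add: Lp_norm_def nn_integral_eq_integral)

text \<open>The admissible constants are cut out by closed conditions, one for each pair of points,
  together with \<open>0 \<le> C\<close>; so their infimum is admissible and is the value of
  \<open>LEAST\<close>.\<close>

lemma lipschitz_on_Lip:
  assumes "\<exists>C. C-lipschitz_on UNIV \<phi>"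
  shows "(Lip \<phi>)-lipschitz_on UNIV \<phi>"
proof -
  define S where "S = {C. C-lipschitz_on UNIV \<phi>}"
  have S: "S = {0..} \<inter> (\<Inter>x y. {C. dist (\<phi> x) (\<phi> y) \<le> C * dist x y})"
    by (auto simp: S_def lipschitz_on_def)
  have "closed S"
    unfolding S by (intro closed_Int closed_INT closed_Collect_le ballI continuous_intros closed_atLeast)
  moreover have "S \<noteq> {}" and bdd: "bdd_below S"
    using assms by (auto simp: S_def intro!: bdd_belowI[of _ 0] lipschitz_on_nonneg)
  ultimately have "Inf S \<in> S"
    by (intro closed_contains_Inf)
  moreover have "Lip \<phi> = Inf S"
    unfolding Lip_def
    using \<open>Inf S \<in> S\<close> cInf_lower[OF _ bdd] by (intro Least_equality) (auto simp: S_def)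
  ultimately show ?thesis
    by (simp add: S_def)
qed

section \<open>The inequality for increasing functions\<close>

context prob_space
begin

lemma Lp_norm_top_mono_lipschitz_le:
  fixes f :: "'a \<Rightarrow> real" and \<phi> :: "real \<Rightarrow> real"
  assumes "mono \<phi>" and L: "L-lipschitz_on UNIV \<phi>"
    and [measurable]: "f \<in> borel_measurable M" and B: "AE x in M. \<bar>f x\<bar> \<le> B"
  shows "Lp_norm M \<infinity> (\<lambda>x. \<phi> (f x) - (\<integral>y. \<phi> (f y) \<partial>M))
    \<le> ennreal L * Lp_norm M \<infinity> (\<lambda>x. f x - (\<integral>y. f y \<partial>M))"
proof -
  define m c where "m = (\<integral>y. f y \<partial>M)"
    and "c = enn2real (esssup M (\<lambda>x. ennreal \<bar>f x - m\<bar>))"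
  have cont: "continuous_on UNIV \<phi>"
    using L by (rule lipschitz_on_continuous_on)
  have [measurable]: "\<phi> \<in> borel_measurable borel"
    using cont by (rule borel_measurable_continuous_onI)
  have int: "integrable M f" "integrable M (\<lambda>x. \<phi> (f x))"
    using integrable_continuous_bounded[OF assms(3) B] cont by (auto intro: continuous_on_id)
  \<comment> \<open>This crude bound makes the essential supremum finite, hence equal to the real
    number \<open>c\<close>.\<close>
  have "esssup M (\<lambda>x. ennreal \<bar>f x - m\<bar>) \<le> ennreal (B + \<bar>m\<bar>)"
    using B by (intro esssup_I) (auto elim!: eventually_mono intro!: ennreal_leI)
  then have c: "esssup M (\<lambda>x. ennreal \<bar>f x - m\<bar>) = ennreal c"
    unfolding c_def by (metis ennreal_enn2real ennreal_less_top le_less_trans)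
  have "0 \<le> c"
    by (simp add: c_def)
  have near: "AE x in M. \<bar>f x - m\<bar> \<le> c"
    using esssup_AE[of "\<lambda>x. ennreal \<bar>f x - m\<bar>" M] \<open>0 \<le> c\<close> by (simp add: c)
  have slope: "\<phi> t - \<phi> s \<le> L * (t - s)" if "s \<le> t" for s t
    using lipschitz_onD[OF L, of t s] that by (simp add: dist_real_def)
  \<comment> \<open>Almost surely \<open>f x \<le> m + c\<close>, so \<open>slope\<close> applies;
    the right side integrates to \<open>L * c\<close> because \<open>f\<close> has mean
    \<open>m\<close>.\<close>
  have "(\<integral>x. \<phi> (m + c) - \<phi> (f x) \<partial>M) \<le> (\<integral>x. L * (m + c - f x) \<partial>M)"
    using near int by (intro integral_mono_AE) (auto elim!: eventually_mono intro!: slope)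
  then have upper: "\<phi> (m + c) - (\<integral>x. \<phi> (f x) \<partial>M) \<le> L * c"
    using int by (simp add: prob_space m_def)
  have "(\<integral>x. \<phi> (f x) - \<phi> (m - c) \<partial>M) \<le> (\<integral>x. L * (f x - (m - c)) \<partial>M)"
    using near int by (intro integral_mono_AE) (auto elim!: eventually_mono intro!: slope)
  then have lower: "(\<integral>x. \<phi> (f x) \<partial>M) - \<phi> (m - c) \<le> L * c"
    using int by (simp add: prob_space m_def)
  have "AE x in M. \<bar>\<phi> (f x) - (\<integral>y. \<phi> (f y) \<partial>M)\<bar> \<le> L * c"
    using near
  proof eventually_elim
    case (elim x)
    then have "\<phi> (f x) \<le> \<phi> (m + c)" "\<phi> (m - c) \<le> \<phi> (f x)"
      by (auto intro!: monoD[OF \<open>mono \<phi>\<close>])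
    with upper lower show ?case
      by linarith
  qed
  then have "esssup M (\<lambda>x. ennreal \<bar>\<phi> (f x) - (\<integral>y. \<phi> (f y) \<partial>M)\<bar>) \<le> ennreal (L * c)"
    by (intro esssup_I) (auto elim!: eventually_mono intro!: ennreal_leI)
  also have "\<dots> = ennreal L * ennreal c"
    using lipschitz_on_nonneg[OF L] \<open>0 \<le> c\<close> by (simp add: ennreal_mult)
  finally show ?thesis
    using c by (simp add: Lp_norm_def m_def)
qed

lemma Lp_norm_real_mono_lipschitz_le:
  fixes f :: "'a \<Rightarrow> real" and \<phi> :: "real \<Rightarrow> real"
  assumes "1 \<le> q" "mono \<phi>" and L: "L-lipschitz_on UNIV \<phi>"
    and f: "f \<in> borel_measurable M" "AE x in M. \<bar>f x\<bar> \<le> B"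
  shows "Lp_norm M (ennreal q) (\<lambda>x. \<phi> (f x) - (\<integral>y. \<phi> (f y) \<partial>M))
    \<le> ennreal L * Lp_norm M (ennreal q) (\<lambda>x. f x - (\<integral>y. f y \<partial>M))"
proof -
  define m n where "m = (\<integral>y. f y \<partial>M)" and "n = (\<integral>y. \<phi> (f y) \<partial>M)"
  define g h where "g = (\<lambda>s. \<phi> s - n)" and "h = (\<lambda>s. L * (s - m) - (\<phi> s - n))"
  note int = integrable_continuous_bounded[OF f]
  have "0 \<le> L"
    using L by (rule lipschitz_on_nonneg)
  have cont [continuous_intros]: "continuous_on UNIV \<phi>"
    using L by (rule lipschitz_on_continuous_on)
  have cont_h: "continuous_on UNIV h"
    unfolding h_def by (intro continuous_intros)
  have "mono g"
    using monoD[OF \<open>mono \<phi>\<close>] by (auto simp: g_def intro!: monoI)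
  \<comment> \<open>The Lipschitz bound enters here: \<open>\<phi>\<close> grows by at most
    \<open>L * (t - s)\<close> between \<open>s\<close> and \<open>t\<close>.\<close>
  have "mono h"
  proof (rule monoI)
    fix s t :: real
    assume "s \<le> t"
    then show "h s \<le> h t"
      using lipschitz_onD[OF L, of t s] by (simp add: h_def dist_real_def algebra_simps)
  qed
  have mean: "(\<integral>x. h (f x) \<partial>M) = 0"
    using int[OF cont] int[OF continuous_on_id]
    by (simp add: h_def prob_space m_def n_def)
  have ints: "integrable M (\<lambda>x. \<bar>g (f x)\<bar> powr q)" "integrable M (\<lambda>x. \<bar>f x - m\<bar> powr q)"
    "integrable M (\<lambda>x. \<bar>g (f x) + h (f x)\<bar> powr q)"
    unfolding g_def h_def using \<open>1 \<le> q\<close>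
    by (intro int continuous_on_powr' continuous_intros; simp)+
  have "(\<integral>x. \<bar>g (f x)\<bar> powr q \<partial>M) \<le> (\<integral>x. \<bar>g (f x) + h (f x)\<bar> powr q \<partial>M)"
    using ints by (intro expectation_convex_add_mono_ge[where \<psi> = "\<lambda>x. \<bar>x\<bar> powr q"]
      \<open>mono g\<close> \<open>mono h\<close> cont_h convex_on_abs_powr \<open>1 \<le> q\<close> int[OF cont_h] mean)
  \<comment> \<open>The sum \<open>g s + h s\<close> collapses to
    \<open>L * (s - m)\<close>.\<close>
  also have "\<dots> = L powr q * (\<integral>x. \<bar>f x - m\<bar> powr q \<partial>M)"
    using \<open>0 \<le> L\<close> by (simp add: g_def h_def abs_mult powr_mult)
  finally have "(\<integral>x. \<bar>g (f x)\<bar> powr q \<partial>M) powr (1 / q)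
      \<le> (L powr q * (\<integral>x. \<bar>f x - m\<bar> powr q \<partial>M)) powr (1 / q)"
    using \<open>1 \<le> q\<close> by (intro powr_mono2) auto
  also have "\<dots> = L * (\<integral>x. \<bar>f x - m\<bar> powr q \<partial>M) powr (1 / q)"
    using \<open>0 \<le> L\<close> \<open>1 \<le> q\<close> by (simp add: powr_mult powr_powr)
  finally show ?thesis
    using ints \<open>0 \<le> L\<close> \<open>1 \<le> q\<close>
    by (simp add: Lp_norm_integrable g_def m_def n_def ennreal_leI flip: ennreal_mult)
qed

text \<open>With an arbitrary Lipschitz constant \<open>L\<close>, the bound applies to
  \<open>- \<phi>\<close> and \<open>Lip \<phi>\<close> without computing the least constant of
  \<open>- \<phi>\<close>.\<close>

lemma Lp_norm_mono_lipschitz_le: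
  fixes f :: "'a \<Rightarrow> real" and \<phi> :: "real \<Rightarrow> real"
  assumes "1 \<le> p" "mono \<phi>" "L-lipschitz_on UNIV \<phi>"
    and "f \<in> borel_measurable M" "AE x in M. \<bar>f x\<bar> \<le> B"
  shows "Lp_norm M p (\<lambda>x. \<phi> (f x) - (\<integral>y. \<phi> (f y) \<partial>M))
    \<le> ennreal L * Lp_norm M p (\<lambda>x. f x - (\<integral>y. f y \<partial>M))"
proof (cases p)
  case (real q)
  with \<open>1 \<le> p\<close> have "1 \<le> q"
    by simp
  then show ?thesis
    unfolding real using assms by (intro Lp_norm_real_mono_lipschitz_le)
next
  case top
  then show ?thesis
    using Lp_norm_top_mono_lipschitz_le[OF assms(2-)] by simp
qed

end

theorem theorem3:
  fixes M :: "'a measure" and p :: ennreal and \<phi> :: "real \<Rightarrow> real" and f :: "'a \<Rightarrow> real"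
  assumes "prob_space M"
    and "1 \<le> p"
    and "mono \<phi> \<or> antimono \<phi>"
    and "\<exists>C. C-lipschitz_on UNIV \<phi>"
    and "f \<in> Lp_space M \<infinity>"
  shows "Lp_norm M p (\<lambda>x. \<phi> (f x) - (\<integral>y. \<phi> (f y) \<partial>M))
    \<le> ennreal (Lip \<phi>) * Lp_norm M p (\<lambda>x. f x - (\<integral>y. f y \<partial>M))"
proof -
  interpret prob_space M
    by fact
  have L: "(Lip \<phi>)-lipschitz_on UNIV \<phi>"
    using assms(4) by (rule lipschitz_on_Lip)
  have f: "f \<in> borel_measurable M" and "esssup M (\<lambda>x. ennreal \<bar>f x\<bar>) < \<infinity>"
    using assms(5) by (auto simp: Lp_space_def Lp_norm_def)
  then obtain B where "0 \<le> B" "esssup M (\<lambda>x. ennreal \<bar>f x\<bar>) = ennreal B"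
    by (cases "esssup M (\<lambda>x. ennreal \<bar>f x\<bar>)") auto
  then have B: "AE x in M. \<bar>f x\<bar> \<le> B"
    using esssup_AE[of "\<lambda>x. ennreal \<bar>f x\<bar>" M] by simp
  show ?thesis
    using assms(3)
  proof
    assume "mono \<phi>"
    then show ?thesis
      using Lp_norm_mono_lipschitz_le assms(2) L f B by blast
  next
    assume "antimono \<phi>"
    then have mono: "mono (\<lambda>t. - \<phi> t)"
      by (auto simp: monotone_def)
    have neg: "(Lip \<phi>)-lipschitz_on UNIV (\<lambda>t. - \<phi> t)"
      using L by simp
    \<comment> \<open>The two centred functions differ only by a sign, which the absolute value in
      \<open>Lp_norm\<close> removes.\<close>
    have "Lp_norm M p (\<lambda>x. \<phi> (f x) - (\<integral>y. \<phi> (f y) \<partial>M))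
        = Lp_norm M p (\<lambda>x. - \<phi> (f x) - (\<integral>y. - \<phi> (f y) \<partial>M))"
      by (simp add: Lp_norm_def abs_minus_commute)
    also have "\<dots> \<le> ennreal (Lip \<phi>) * Lp_norm M p (\<lambda>x. f x - (\<integral>y. f y \<partial>M))"
      using Lp_norm_mono_lipschitz_le[OF assms(2) mono neg f B] .
    finally show ?thesis .
  qed
qed

end
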